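(* Let $X$ be a finite set and let $G$ be the structure group of a non-degenerate and braided permutation solution $(X,S)$ that is not necessarily involutive. Then $G$ is a Garside group.
   Context: A permutation solution is a pair $(X,S)$, with $X$ a non-empty set, where $S:X^2\to X^2$ has the form $S(x,y)=(g(y),f(x))$ for maps $f,g:X\to X$. It is non-degenerate iff $f,g$ are bijective, braided (i.e. $S^{12}S^{23}S^{12}=S^{23}S^{12}S^{23}$ on $X^3$, where $S^{12}=S\times\mathrm{id}_X$, $S^{23}=\mathrm{id}_X\times S$) iff $fg=gf$, and involutive ($S^2=\mathrm{id}$) iff $g=f^{-1}$. The structure group of $(X,S)$ is the group generated by $X$ with defining relations $xy=tz$ whenever $S(x,y)=(t,z)$. A monoid is Gaussian if it is atomic (generated by its atoms, with the lengths of decompositions of each element into atoms bounded), left and right cancellative, and any two elements have left and right gcds and lcms (with respect to divisibility). A Garside element of a monoid is an element whose left divisors coincide with its right divisors, are finite in number, and generate the monoid. A Garside monoid is a Gaussian monoid containing a Garside element, and a Garside group is the group of fractions of a Garside monoid. *)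

theory Defs
  imports "HOL-Algebra.Divisibility"
begin

section \<open>Permutation solutions\<close>

definition permutation_solution :: "'a set \<Rightarrow> ('a \<times> 'a \<Rightarrow> 'a \<times> 'a) \<Rightarrow> bool" where
  "permutation_solution X S \<longleftrightarrow> X \<noteq> {} \<and>
     (\<exists>f g. f \<in> X \<rightarrow> X \<and> g \<in> X \<rightarrow> X \<and> (\<forall>x\<in>X. \<forall>y\<in>X. S (x, y) = (g y, f x)))"

text \<open>For a general map, written S(x, y) = (g_x(y), f_y(x)), non-degeneracy means that all g_x and
  all f_y are bijections of X. For a permutation solution it says that f and g are bijections, see
  \<open>non_degenerate_iff\<close> below.\<close>

definition non_degenerate :: "'a set \<Rightarrow> ('a \<times> 'a \<Rightarrow> 'a \<times> 'a) \<Rightarrow> bool" where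
  "non_degenerate X S \<longleftrightarrow>
     (\<forall>x\<in>X. bij_betw (\<lambda>y. fst (S (x, y))) X X) \<and> (\<forall>y\<in>X. bij_betw (\<lambda>x. snd (S (x, y))) X X)"

definition map12 :: "('a \<times> 'a \<Rightarrow> 'a \<times> 'a) \<Rightarrow> 'a \<times> 'a \<times> 'a \<Rightarrow> 'a \<times> 'a \<times> 'a" where
  "map12 S = (\<lambda>(x, y, z). let (x', y') = S (x, y) in (x', y', z))"

definition map23 :: "('a \<times> 'a \<Rightarrow> 'a \<times> 'a) \<Rightarrow> 'a \<times> 'a \<times> 'a \<Rightarrow> 'a \<times> 'a \<times> 'a" where
  "map23 S = (\<lambda>(x, y, z). (x, S (y, z)))"

definition braided :: "'a set \<Rightarrow> ('a \<times> 'a \<Rightarrow> 'a \<times> 'a) \<Rightarrow> bool" where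
  "braided X S \<longleftrightarrow>
     (\<forall>t \<in> X \<times> X \<times> X. map12 S (map23 S (map12 S t)) = map23 S (map12 S (map23 S t)))"

lemma non_degenerate_iff:
  assumes "X \<noteq> {}" and S: "\<And>x y. x \<in> X \<Longrightarrow> y \<in> X \<Longrightarrow> S (x, y) = (g y, f x)"
  shows "non_degenerate X S \<longleftrightarrow> bij_betw f X X \<and> bij_betw g X X"
proof -
  have "bij_betw (\<lambda>y. fst (S (x, y))) X X = bij_betw g X X" if "x \<in> X" for x
    using that by (intro bij_betw_cong) (simp add: S)
  moreover have "bij_betw (\<lambda>x. snd (S (x, y))) X X = bij_betw f X X" if "y \<in> X" for y
    using that by (intro bij_betw_cong) (simp add: S)
  ultimately show ?thesis
    using assms(1) by (auto simp: non_degenerate_def)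
qed

lemma braided_iff:
  assumes "X \<noteq> {}" "f \<in> X \<rightarrow> X" "g \<in> X \<rightarrow> X"
    and S: "\<And>x y. x \<in> X \<Longrightarrow> y \<in> X \<Longrightarrow> S (x, y) = (g y, f x)"
  shows "braided X S \<longleftrightarrow> (\<forall>x\<in>X. f (g x) = g (f x))"
proof -
  have m: "f x \<in> X" "g x \<in> X" if "x \<in> X" for x
    using assms(2,3) that by auto
  show ?thesis
    using assms(1) by (auto simp: braided_def map12_def map23_def S m)
qed


section \<open>Groups given by generators and relations\<close>

text \<open>Words are lists of signed letters: \<open>(x, True)\<close> stands for the generator x and \<open>(x, False)\<close>
  for its formal inverse. \<open>word_cong X R\<close> is the least congruence on the words over X
  containing free cancellation and the relators in R.\<close>

type_synonym 'a word = "('a \<times> bool) list"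

definition words :: "'a set \<Rightarrow> 'a word set" where
  "words X = lists (X \<times> UNIV)"

inductive word_cong :: "'a set \<Rightarrow> ('a word \<times> 'a word) set \<Rightarrow> 'a word \<Rightarrow> 'a word \<Rightarrow> bool"
  for X R where
  refl: "u \<in> words X \<Longrightarrow> word_cong X R u u"
| sym: "word_cong X R u v \<Longrightarrow> word_cong X R v u"
| trans: "word_cong X R u v \<Longrightarrow> word_cong X R v w \<Longrightarrow> word_cong X R u w"
| append: "word_cong X R u u' \<Longrightarrow> word_cong X R v v' \<Longrightarrow> word_cong X R (u @ v) (u' @ v')"
| cancel: "x \<in> X \<Longrightarrow> word_cong X R [(x, b), (x, \<not> b)] []"
| relation: "(u, v) \<in> R \<Longrightarrow> u \<in> words X \<Longrightarrow> v \<in> words X \<Longrightarrow> word_cong X R u v"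

definition word_class :: "'a set \<Rightarrow> ('a word \<times> 'a word) set \<Rightarrow> 'a word \<Rightarrow> 'a word set" where
  "word_class X R u = {v. word_cong X R u v}"

definition presented_group :: "'a set \<Rightarrow> ('a word \<times> 'a word) set \<Rightarrow> 'a word set monoid" where
  "presented_group X R =
     \<lparr>carrier = word_class X R ` words X,
      mult = (\<lambda>A B. \<Union>u\<in>A. \<Union>v\<in>B. word_class X R (u @ v)),
      one = word_class X R []\<rparr>"

definition structure_group :: "'a set \<Rightarrow> ('a \<times> 'a \<Rightarrow> 'a \<times> 'a) \<Rightarrow> 'a word set monoid" where
  "structure_group X S =
     presented_group X {([(x, True), (y, True)], [(t, True), (z, True)]) | x y t z.
                          x \<in> X \<and> y \<in> X \<and> S (x, y) = (t, z)}"

lemma word_cong_words: "word_cong X R u v \<Longrightarrow> u \<in> words X \<and> v \<in> words X"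
  by (induction rule: word_cong.induct) (auto simp: words_def)

lemma word_class_eq_iff:
  assumes "u \<in> words X"
  shows "word_class X R u = word_class X R v \<longleftrightarrow> word_cong X R u v"
proof
  assume "word_class X R u = word_class X R v"
  then have "word_cong X R v u"
    using word_cong.refl[OF assms] unfolding word_class_def by blast
  then show "word_cong X R u v"
    by (rule word_cong.sym)
next
  assume uv: "word_cong X R u v"
  show "word_class X R u = word_class X R v"
    unfolding word_class_def
    using word_cong.trans[OF uv] word_cong.trans[OF word_cong.sym[OF uv]] by blast
qed

lemma presented_group_mult:
  assumes "u \<in> words X" "v \<in> words X"
  shows "word_class X R u \<otimes>\<^bsub>presented_group X R\<^esub> word_class X R v = word_class X R (u @ v)"
proof -
  have eq: "word_class X R (u' @ v') = word_class X R (u @ v)"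
    if "word_cong X R u u'" "word_cong X R v v'" for u' v'
  proof -
    have c: "word_cong X R (u @ v) (u' @ v')"
      using that by (rule word_cong.append)
    then have "u @ v \<in> words X"
      by (simp add: word_cong_words)
    then show ?thesis
      using c word_class_eq_iff by blast
  qed
  have "word_cong X R u u" "word_cong X R v v"
    using assms by (simp_all add: word_cong.refl)
  then have "(\<Union>u'\<in>word_class X R u. \<Union>v'\<in>word_class X R v. word_class X R (u' @ v')) =
      word_class X R (u @ v)"
    using eq unfolding word_class_def[of X R u] word_class_def[of X R v] by blast
  then show ?thesis
    by (simp add: presented_group_def)
qed

lemma group_presented_group: "group (presented_group X R)"
proof (rule groupI)
  let ?G = "presented_group X R"
  have car: "carrier ?G = word_class X R ` words X" and one: "\<one>\<^bsub>?G\<^esub> = word_class X R []"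
    by (simp_all add: presented_group_def)
  have app: "u @ v \<in> words X" if "u \<in> words X" "v \<in> words X" for u v :: "'a word"
    using that by (simp add: words_def)
  have nil: "[] \<in> words X"
    by (simp add: words_def)
  show "\<one>\<^bsub>?G\<^esub> \<in> carrier ?G"
    using nil by (simp add: car one)
  show "x \<otimes>\<^bsub>?G\<^esub> y \<in> carrier ?G" if "x \<in> carrier ?G" "y \<in> carrier ?G" for x y
    using that app by (auto simp: car presented_group_mult)
  show "x \<otimes>\<^bsub>?G\<^esub> y \<otimes>\<^bsub>?G\<^esub> z = x \<otimes>\<^bsub>?G\<^esub> (y \<otimes>\<^bsub>?G\<^esub> z)"
    if "x \<in> carrier ?G" "y \<in> carrier ?G" "z \<in> carrier ?G" for x y z
    using that app by (auto simp: car presented_group_mult)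
  show "\<one>\<^bsub>?G\<^esub> \<otimes>\<^bsub>?G\<^esub> x = x" if "x \<in> carrier ?G" for x
    using that nil by (auto simp: car one presented_group_mult)
  have inv: "\<exists>v\<in>words X. word_cong X R (v @ u) []" if "u \<in> words X" for u
    using that
  proof (induction u)
    case Nil
    then show ?case using nil word_cong.refl[OF nil] by (intro bexI[of _ "[]"]) auto
  next
    case (Cons l u)
    obtain x b where l: "l = (x, b)" by (cases l)
    have x: "x \<in> X" and u: "u \<in> words X"
      using Cons.prems by (auto simp: words_def l)
    obtain v where v: "v \<in> words X" "word_cong X R (v @ u) []"
      using Cons.IH[OF u] by blast
    have "word_cong X R [(x, \<not> b), (x, b)] []"
      using word_cong.cancel[OF x, of R "\<not> b"] by simp
    then have "word_cong X R ([(x, \<not> b), (x, b)] @ u) ([] @ u)"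
      using u by (blast intro: word_cong.append word_cong.refl)
    then have "word_cong X R (v @ [(x, \<not> b), (x, b)] @ u) (v @ [] @ u)"
      using v by (blast intro: word_cong.append word_cong.refl)
    then have "word_cong X R ((v @ [(x, \<not> b)]) @ l # u) (v @ u)"
      by (simp add: l)
    then have "word_cong X R ((v @ [(x, \<not> b)]) @ l # u) []"
      using v(2) by (rule word_cong.trans)
    moreover have "v @ [(x, \<not> b)] \<in> words X"
      using v(1) x by (simp add: words_def)
    ultimately show ?case by blast
  qed
  show "\<exists>y\<in>carrier ?G. y \<otimes>\<^bsub>?G\<^esub> x = \<one>\<^bsub>?G\<^esub>" if x: "x \<in> carrier ?G" for x
  proof -
    obtain u where u: "u \<in> words X" "x = word_class X R u"
      using x by (auto simp: car)
    obtain v where v: "v \<in> words X" "word_cong X R (v @ u) []"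
      using inv[OF u(1)] by blast
    then have "word_class X R v \<otimes>\<^bsub>?G\<^esub> x = \<one>\<^bsub>?G\<^esub>"
      using u app by (simp add: presented_group_mult one word_class_eq_iff)
    then show ?thesis
      using v(1) by (auto simp: car)
  qed
qed


section \<open>Garside monoids and Garside groups\<close>

definition atoms :: "('m, 'b) monoid_scheme \<Rightarrow> 'm set" where
  "atoms M = {a \<in> carrier M. a \<noteq> \<one>\<^bsub>M\<^esub> \<and>
     (\<forall>b\<in>carrier M. \<forall>c\<in>carrier M. a = b \<otimes>\<^bsub>M\<^esub> c \<longrightarrow> b = \<one>\<^bsub>M\<^esub> \<or> c = \<one>\<^bsub>M\<^esub>)}"

definition decomposition :: "('m, 'b) monoid_scheme \<Rightarrow> 'm set \<Rightarrow> 'm list \<Rightarrow> 'm \<Rightarrow> bool" where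
  "decomposition M A as x \<longleftrightarrow> set as \<subseteq> A \<and> foldr (\<otimes>\<^bsub>M\<^esub>) as \<one>\<^bsub>M\<^esub> = x"

definition monoid_generated_by :: "('m, 'b) monoid_scheme \<Rightarrow> 'm set \<Rightarrow> bool" where
  "monoid_generated_by M A \<longleftrightarrow> A \<subseteq> carrier M \<and> (\<forall>x\<in>carrier M. \<exists>as. decomposition M A as x)"

definition atomic_monoid :: "('m, 'b) monoid_scheme \<Rightarrow> bool" where
  "atomic_monoid M \<longleftrightarrow> monoid M \<and> monoid_generated_by M (atoms M) \<and>
     (\<forall>x\<in>carrier M. \<exists>n. \<forall>as. decomposition M (atoms M) as x \<longrightarrow> length as \<le> n)"

text \<open>In a non-commutative monoid the library's \<open>divides\<close> is left divisibility, that is,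
  \<open>a\<close> divides \<open>b\<close> iff \<open>b = a \<otimes> c\<close> for some \<open>c\<close>. Right divisibility is left divisibility in
  the opposite monoid.\<close>

definition opposite_monoid :: "('m, 'b) monoid_scheme \<Rightarrow> ('m, 'b) monoid_scheme" where
  "opposite_monoid M = M\<lparr>mult := (\<lambda>x y. y \<otimes>\<^bsub>M\<^esub> x)\<rparr>"

definition has_gcds_lcms :: "('m, 'b) monoid_scheme \<Rightarrow> bool" where
  "has_gcds_lcms M \<longleftrightarrow> (\<forall>a\<in>carrier M. \<forall>b\<in>carrier M.
     (\<exists>d\<in>carrier M. d gcdof\<^bsub>M\<^esub> a b) \<and> (\<exists>m\<in>carrier M. m lcmof\<^bsub>M\<^esub> a b))"

definition gaussian_monoid :: "('m, 'b) monoid_scheme \<Rightarrow> bool" where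
  "gaussian_monoid M \<longleftrightarrow> atomic_monoid M \<and> monoid_cancel M \<and>
     has_gcds_lcms M \<and> has_gcds_lcms (opposite_monoid M)"

definition left_divisors :: "('m, 'b) monoid_scheme \<Rightarrow> 'm \<Rightarrow> 'm set" where
  "left_divisors M x = {a \<in> carrier M. a divides\<^bsub>M\<^esub> x}"

definition right_divisors :: "('m, 'b) monoid_scheme \<Rightarrow> 'm \<Rightarrow> 'm set" where
  "right_divisors M x = {a \<in> carrier M. a divides\<^bsub>opposite_monoid M\<^esub> x}"

definition garside_element :: "('m, 'b) monoid_scheme \<Rightarrow> 'm \<Rightarrow> bool" where
  "garside_element M \<Delta> \<longleftrightarrow> \<Delta> \<in> carrier M \<and> left_divisors M \<Delta> = right_divisors M \<Delta> \<and>
     finite (left_divisors M \<Delta>) \<and> monoid_generated_by M (left_divisors M \<Delta>)"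

definition garside_monoid :: "('m, 'b) monoid_scheme \<Rightarrow> bool" where
  "garside_monoid M \<longleftrightarrow> gaussian_monoid M \<and> (\<exists>\<Delta>. garside_element M \<Delta>)"

text \<open>A Gaussian monoid satisfies the Ore conditions on both sides, so it embeds in its group of
  fractions, which is both a group of left fractions and a group of right fractions.\<close>

definition group_of_fractions ::
    "('m, 'b) monoid_scheme \<Rightarrow> ('g, 'c) monoid_scheme \<Rightarrow> bool" where
  "group_of_fractions M G \<longleftrightarrow> group G \<and>
     (\<exists>h \<in> hom M G. inj_on h (carrier M) \<and>
        (\<forall>x\<in>carrier G. \<exists>a\<in>carrier M. \<exists>b\<in>carrier M. x = inv\<^bsub>G\<^esub> (h a) \<otimes>\<^bsub>G\<^esub> h b) \<and>
        (\<forall>x\<in>carrier G. \<exists>a\<in>carrier M. \<exists>b\<in>carrier M. x = h a \<otimes>\<^bsub>G\<^esub> inv\<^bsub>G\<^esub> (h b)))"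

text \<open>Taking the elements of M from the element type of G is no restriction, since M embeds in G.\<close>

definition garside_group :: "('g, 'c) monoid_scheme \<Rightarrow> bool" where
  "garside_group G \<longleftrightarrow> (\<exists>M :: 'g monoid. garside_monoid M \<and> group_of_fractions M G)"

end

theory Submission
  imports Defs "HOL-Combinatorics.Cycles"
begin

text \<open>Write \<open>S (x, y) = (g y, f x)\<close>. In the structure group \<open>G\<close> the relation
  \<open>x \<cdot> f x = g (f x) \<cdot> f x\<close> cancels to \<open>x = g (f x)\<close>. So even though the solution need not be
  involutive, it becomes so on the set \<open>Y\<close> of the images of the generators in \<open>G\<close>: the relations say
  exactly that \<open>x \<cdot> f z = z \<cdot> f x\<close>, and \<open>f\<close> induces a permutation \<open>p\<close> of \<open>Y\<close>.

  This relation is commutativity up to a twist. Let the free abelian group on \<open>Y\<close> be acted on by the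
  integers through \<open>p\<close>, and send each generator \<open>y\<close> to the pair of the basis vector of \<open>y\<close> and the
  generator of the integers. Then \<open>y \<cdot> p z\<close> and \<open>z \<cdot> p y\<close> have the same image in the semidirect
  product. The submonoid \<open>M\<close> of \<open>G\<close> generated by the generators is carried by this map bijectively
  onto the set of vectors \<open>v\<close> with nonnegative entries (the second component is the sum \<open>|v|\<close> of the
  entries, so it can be dropped), with the product \<open>v \<cdot> w = v + w \<circ> p^|v|\<close>. That words
  equal in \<open>G\<close> have equal vectors is seen by letting words act on integer-valued functions by the
  corresponding affine bijections (\<open>action_cong\<close>). That positive words with equal vectors are equal in
  \<open>G\<close> is seen by moving a letter with a nonzero entry to the front of the word (\<open>positive_front\<close>).

  For any monoid with such coordinates, left divisibility is the pointwise order
  (\<open>divides_iff\<close>), so least common multiples and greatest common divisors are pointwise maxima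
  and minima. The opposite monoid has coordinates of the same kind, with \<open>p\<close> inverted
  (\<open>opposite_is_twisted\<close>), so everything holds on the right as well. The all-ones vector on \<open>Y\<close> is
  invariant under \<open>p\<close> and is therefore a Garside element. Finally, common multiples in
  \<open>M\<close> bring every element of \<open>G\<close>, being a product of generators and their inverses, into the form of a
  fraction (\<open>right_fraction\<close>).\<close>

section \<open>Twisted free commutative monoids\<close>

text \<open>The coordinates \<open>c\<close> identify \<open>M\<close> with the elements \<open>(v, |v|)\<close> of the semidirect product of the
  vectors over \<open>Y\<close> and the powers of \<open>p\<close>. Keeping \<open>c\<close> as a map, instead of taking \<open>M\<close> to be the set
  of vectors, lets the results be used for submonoids of a given group.\<close>

locale twisted_free_commutative_monoid = monoid M
  for M :: "('m, 'e) monoid_scheme" (structure) +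
  fixes Y :: "'b set" and p :: "'b \<Rightarrow> 'b" and c :: "'m \<Rightarrow> 'b \<Rightarrow> nat"
  assumes finite_Y: "finite Y"
    and p_permutes: "p permutes Y"
    and bij_c: "bij_betw c (carrier M) {v. \<forall>y. y \<notin> Y \<longrightarrow> v y = 0}"
    and c_mult: "\<And>a b. a \<in> carrier M \<Longrightarrow> b \<in> carrier M \<Longrightarrow>
      c (a \<otimes> b) = (\<lambda>y. c a y + c b ((p ^^ (\<Sum>z\<in>Y. c a z)) y))"
begin

definition degree :: "'m \<Rightarrow> nat" where
  "degree a = (\<Sum>y\<in>Y. c a y)"

lemma c_mult': "a \<in> carrier M \<Longrightarrow> b \<in> carrier M \<Longrightarrow>
      c (a \<otimes> b) = (\<lambda>y. c a y + c b ((p ^^ degree a) y))"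
  by (simp add: c_mult degree_def)

abbreviation p_inv :: "'b \<Rightarrow> 'b" where
  "p_inv \<equiv> inv_into UNIV p"

lemma p_power_permutes: "(p ^^ n) permutes Y" and p_inv_power_permutes: "(p_inv ^^ n) permutes Y"
  by (rule permutes_funpow[OF p_permutes],
      rule permutes_funpow[OF permutes_inv[OF p_permutes]])

lemma p_power_inverses [simp]: "(p ^^ n) ((p_inv ^^ n) y) = y" "(p_inv ^^ n) ((p ^^ n) y) = y"
  unfolding inv_fn[OF permutes_bij[OF p_permutes], of n, symmetric]
  by (rule permutes_inverses[OF p_power_permutes])+

lemma c_outside: "a \<in> carrier M \<Longrightarrow> y \<notin> Y \<Longrightarrow> c a y = 0"
  using bij_betwE[OF bij_c] by blast

lemma c_inject: "a \<in> carrier M \<Longrightarrow> b \<in> carrier M \<Longrightarrow> c a = c b \<longleftrightarrow> a = b"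
  using bij_c by (auto simp: bij_betw_def inj_on_def)

lemma ex_element:
  assumes "\<forall>y. y \<notin> Y \<longrightarrow> v y = 0"
  shows "\<exists>a\<in>carrier M. c a = v"
proof -
  have "v \<in> c ` carrier M"
    using bij_betw_imp_surj_on[OF bij_c] assms by simp
  then show ?thesis
    by auto
qed

lemma degree_mult:
  assumes "a \<in> carrier M" "b \<in> carrier M"
  shows "degree (a \<otimes> b) = degree a + degree b"
proof -
  have "(\<Sum>y\<in>Y. c b ((p ^^ degree a) y)) = degree b"
    using sum.permute[OF p_power_permutes, of "c b" "degree a"] by (simp add: degree_def comp_def)
  then show ?thesis
    by (simp add: degree_def[of "a \<otimes> b"] c_mult' assms sum.distrib) (simp add: degree_def)
qed

lemma c_eq_zero_iff:
  assumes "a \<in> carrier M"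
  shows "degree a = 0 \<longleftrightarrow> c a = (\<lambda>_. 0)"
  using assms finite_Y c_outside[OF assms] by (auto simp: degree_def fun_eq_iff)

lemma degree_one: "degree \<one> = 0"
  using degree_mult[of \<one> \<one>] by simp

lemma degree_eq_zero_iff: "a \<in> carrier M \<Longrightarrow> degree a = 0 \<longleftrightarrow> a = \<one>"
  using c_inject c_eq_zero_iff degree_one by (metis one_closed)

text \<open>A quotient \<open>d\<close> with \<open>b = a \<cdot> d\<close> must satisfy \<open>c d \<circ> p^|a| = c b - c a\<close>; this equation
  can be solved because \<open>p\<close> is invertible, as soon as the right-hand side is nonnegative.\<close>

lemma divides_iff:
  assumes a: "a \<in> carrier M" and b: "b \<in> carrier M"
  shows "a divides b \<longleftrightarrow> c a \<le> c b"
proof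
  assume "a divides b"
  then show "c a \<le> c b"
    using a b by (auto simp: factor_def c_mult' le_fun_def)
next
  assume le: "c a \<le> c b"
  let ?q = "p_inv ^^ degree a"
  have "c b (?q y) - c a (?q y) = 0" if "y \<notin> Y" for y
    using that permutes_not_in[OF p_inv_power_permutes] c_outside[OF b] by simp
  then obtain d where d: "d \<in> carrier M" "c d = (\<lambda>y. c b (?q y) - c a (?q y))"
    using ex_element[of "\<lambda>y. c b (?q y) - c a (?q y)"] by blast
  have "c (a \<otimes> d) = c b"
    using le by (simp add: c_mult' a d le_fun_def)
  then show "a divides b"
    using c_inject a b d by (auto simp: factor_def)
qed

lemma left_cancel:
  assumes "a \<in> carrier M" "b \<in> carrier M" "d \<in> carrier M" "a \<otimes> b = a \<otimes> d"
  shows "b = d"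
proof -
  have eq: "c b ((p ^^ degree a) y) = c d ((p ^^ degree a) y)" for y
    using arg_cong[OF assms(4), of c] assms(1-3) by (simp add: c_mult' fun_eq_iff)
  have "c b = c d"
  proof
    fix y
    show "c b y = c d y"
      using eq[of "(p_inv ^^ degree a) y"] by simp
  qed
  then show ?thesis
    using c_inject assms by blast
qed

lemma has_gcds_lcms: "has_gcds_lcms M"
  unfolding has_gcds_lcms_def
proof (intro ballI conjI)
  fix a b assume a: "a \<in> carrier M" and b: "b \<in> carrier M"
  obtain d where d: "d \<in> carrier M" "c d = (\<lambda>y. min (c a y) (c b y))"
    using ex_element[of "\<lambda>y. min (c a y) (c b y)"] c_outside a b by auto
  then show "\<exists>d\<in>carrier M. d gcdof a b"
    using a b by (intro bexI[of _ d]) (auto simp: isgcd_def divides_iff le_fun_def)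
  obtain m where m: "m \<in> carrier M" "c m = (\<lambda>y. max (c a y) (c b y))"
    using ex_element[of "\<lambda>y. max (c a y) (c b y)"] c_outside a b by auto
  then show "\<exists>m\<in>carrier M. m lcmof a b"
    using a b by (intro bexI[of _ m]) (auto simp: islcm_def divides_iff le_fun_def)
qed

text \<open>An element with a nonzero entry at \<open>y\<close> is divisible by the basis vector at \<open>y\<close>, and the quotient has
  smaller degree.\<close>

lemma decomposition_into_degree_one:
  "x \<in> carrier M \<Longrightarrow> \<exists>as. decomposition M {a \<in> carrier M. degree a = 1} as x"
proof (induction "degree x" arbitrary: x)
  case 0
  then show ?case
    using degree_eq_zero_iff by (intro exI[of _ "[]"]) (simp add: decomposition_def)
next
  case (Suc n)
  then obtain y where y: "y \<in> Y" "c x y \<noteq> 0"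
    by (metis degree_def sum.neutral nat.distinct(1))
  obtain a where a: "a \<in> carrier M" "c a = (\<lambda>z. of_bool (z = y))"
    using ex_element[of "\<lambda>z. of_bool (z = y)"] y(1) by auto
  have degree_a: "degree a = 1"
    using y(1) finite_Y by (simp add: degree_def a)
  have "a divides x"
    using y(2) Suc.prems a by (auto simp: divides_iff le_fun_def)
  then obtain d where d: "d \<in> carrier M" "x = a \<otimes> d"
    by (auto simp: factor_def)
  then have "n = degree d"
    using Suc.hyps(2) degree_mult a(1) degree_a by simp
  then obtain as where "decomposition M {a \<in> carrier M. degree a = 1} as d"
    using Suc.hyps(1) d(1) by blast
  then show ?case
    using a(1) degree_a d by (intro exI[of _ "a # as"]) (auto simp: decomposition_def)
qed

lemma monoid_generated_by_if_degree_one: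
  assumes "A \<subseteq> carrier M" "\<And>a. a \<in> carrier M \<Longrightarrow> degree a = 1 \<Longrightarrow> a \<in> A"
  shows "monoid_generated_by M A"
proof -
  have "decomposition M A as x" if "decomposition M {a \<in> carrier M. degree a = 1} as x" for as x
    using that assms(2) by (auto simp: decomposition_def)
  then show ?thesis
    using assms(1) decomposition_into_degree_one unfolding monoid_generated_by_def by blast
qed

text \<open>The degree is additive and vanishes only at the unit. So elements of degree 1 are atoms, and the degree
  of an element bounds the number of atoms in any of its decompositions.\<close>

lemma atomic: "atomic_monoid M"
proof -
  have atomI: "a \<in> atoms M" if "a \<in> carrier M" "degree a = 1" for a
  proof -
    have "a \<noteq> \<one>"
      using that degree_one by auto
    moreover have "b = \<one> \<or> d = \<one>" if bd: "b \<in> carrier M" "d \<in> carrier M" "a = b \<otimes> d" for b d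
    proof -
      have "degree b = 0 \<or> degree d = 0"
        using degree_mult[OF bd(1,2)] \<open>degree a = 1\<close> bd(3) by auto
      then show ?thesis
        using degree_eq_zero_iff bd by auto
    qed
    ultimately show ?thesis
      using that(1) by (simp add: atoms_def)
  qed
  have "length as \<le> degree (foldr (\<otimes>) as \<one>) \<and> foldr (\<otimes>) as \<one> \<in> carrier M" if "set as \<subseteq> atoms M" for as
    using that
  proof (induction as)
    case (Cons a as)
    then have "a \<in> carrier M" "degree a \<noteq> 0"
      by (auto simp: atoms_def degree_eq_zero_iff)
    with Cons show ?case
      by (auto simp: degree_mult)
  qed simp
  then have "\<exists>n. \<forall>as. decomposition M (atoms M) as x \<longrightarrow> length as \<le> n" for x
    by (intro exI[of _ "degree x"]) (auto simp: decomposition_def)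
  moreover have "monoid_generated_by M (atoms M)"
    using atomI by (intro monoid_generated_by_if_degree_one) (auto simp: atoms_def)
  ultimately show ?thesis
    using monoid_axioms by (simp add: atomic_monoid_def)
qed

section \<open>Reversal and the Garside property\<close>

text \<open>Right divisibility of \<open>b\<close> by \<open>a\<close> means \<open>c b = c d + c a \<circ> p^|d|\<close> with \<open>|d| = |b| - |a|\<close>.
  Composing with \<open>p^(-|b|)\<close> turns it into the pointwise comparison of the functions
  \<open>c a \<circ> p^(-|a|)\<close> and \<open>c b \<circ> p^(-|b|)\<close>.\<close>

definition reverse_coordinates :: "'m \<Rightarrow> 'b \<Rightarrow> nat" where
  "reverse_coordinates a = (\<lambda>y. c a ((p_inv ^^ degree a) y))"

lemma sum_reverse_coordinates: "(\<Sum>y\<in>Y. reverse_coordinates a y) = degree a"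
  using sum.permute[OF p_inv_power_permutes, of "c a" "degree a"]
  by (simp add: reverse_coordinates_def degree_def comp_def)

lemma reverse_coordinates_mult:
  assumes "a \<in> carrier M" "b \<in> carrier M"
  shows "reverse_coordinates (a \<otimes> b) =
    (\<lambda>y. reverse_coordinates b y + reverse_coordinates a ((p_inv ^^ degree b) y))"
proof
  fix y
  let ?k = "p_inv ^^ degree b" and ?l = "p_inv ^^ degree a"
  have "p_inv ^^ degree (a \<otimes> b) = ?l \<circ> ?k"
    by (simp add: degree_mult assms funpow_add)
  then show "reverse_coordinates (a \<otimes> b) y =
      reverse_coordinates b y + reverse_coordinates a (?k y)"
    by (simp add: reverse_coordinates_def c_mult' assms)
qed

lemma bij_reverse_coordinates:
  "bij_betw reverse_coordinates (carrier M) {v. \<forall>y. y \<notin> Y \<longrightarrow> v y = 0}"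
proof (rule bij_betw_imageI)
  have c_eq: "c a y = reverse_coordinates a ((p ^^ degree a) y)" for a y
    by (simp add: reverse_coordinates_def)
  show "inj_on reverse_coordinates (carrier M)"
  proof (rule inj_onI)
    fix a b
    assume *: "a \<in> carrier M" "b \<in> carrier M" "reverse_coordinates a = reverse_coordinates b"
    then have "degree a = degree b"
      using sum_reverse_coordinates by metis
    then have "c a = c b"
      using *(3) by (simp add: c_eq fun_eq_iff)
    then show "a = b"
      using c_inject * by blast
  qed
  show "reverse_coordinates ` carrier M = {v. \<forall>y. y \<notin> Y \<longrightarrow> v y = 0}"
  proof (intro equalityI subsetI)
    fix v assume "v \<in> reverse_coordinates ` carrier M"
    then show "v \<in> {v. \<forall>y. y \<notin> Y \<longrightarrow> v y = 0}"
      using c_outside by (auto simp: reverse_coordinates_def permutes_not_in[OF p_inv_power_permutes])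
  next
    fix v :: "'b \<Rightarrow> nat" assume "v \<in> {v. \<forall>y. y \<notin> Y \<longrightarrow> v y = 0}"
    then have v: "v y = 0" if "y \<notin> Y" for y
      using that by blast
    let ?n = "\<Sum>y\<in>Y. v y"
    obtain a where a: "a \<in> carrier M" "c a = (\<lambda>y. v ((p ^^ ?n) y))"
      using ex_element[of "\<lambda>y. v ((p ^^ ?n) y)"] v
      by (auto simp: permutes_not_in[OF p_power_permutes])
    have "degree a = ?n"
      using sum.permute[OF p_power_permutes, of v ?n] by (simp add: degree_def a comp_def)
    then have "reverse_coordinates a = v"
      by (simp add: reverse_coordinates_def a)
    then show "v \<in> reverse_coordinates ` carrier M"
      using a(1) by blast
  qed
qed

text \<open>The class of twisted monoids is closed under reversal, so statements about left divisibility
  give statements about right divisibility.\<close>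

lemma opposite_is_twisted:
  "twisted_free_commutative_monoid (opposite_monoid M) Y p_inv reverse_coordinates"
proof (intro twisted_free_commutative_monoid.intro twisted_free_commutative_monoid_axioms.intro)
  show "monoid (opposite_monoid M)"
    by (rule monoidI) (auto simp: opposite_monoid_def m_assoc)
  show "finite Y" "p_inv permutes Y"
    using finite_Y permutes_inv[OF p_permutes] by auto
  show "bij_betw reverse_coordinates (carrier (opposite_monoid M)) {v. \<forall>y. y \<notin> Y \<longrightarrow> v y = 0}"
    using bij_reverse_coordinates by (simp add: opposite_monoid_def)
  show "reverse_coordinates (a \<otimes>\<^bsub>opposite_monoid M\<^esub> b) =
      (\<lambda>y. reverse_coordinates a y +
        reverse_coordinates b ((p_inv ^^ (\<Sum>z\<in>Y. reverse_coordinates a z)) y))"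
    if "a \<in> carrier (opposite_monoid M)" "b \<in> carrier (opposite_monoid M)" for a b
    using that by (simp add: opposite_monoid_def reverse_coordinates_mult sum_reverse_coordinates)
qed

text \<open>The all-ones vector is fixed by every power of \<open>p\<close>, hence it is its own reverse coordinate vector, and
  being pointwise below it is the same condition in both coordinate systems. Its divisors correspond to the
  subsets of \<open>Y\<close> and include the elements of degree 1.\<close>

theorem garside: "garside_monoid M"
proof -
  let ?O = "opposite_monoid M"
  interpret op: twisted_free_commutative_monoid ?O Y "p_inv" reverse_coordinates
    by (rule opposite_is_twisted)
  have O: "carrier ?O = carrier M" "\<And>a b. a \<otimes>\<^bsub>?O\<^esub> b = b \<otimes> a"
    by (simp_all add: opposite_monoid_def)
  have "monoid_cancel M"
  proof
    show "b = d" if "a \<otimes> b = a \<otimes> d" "a \<in> carrier M" "b \<in> carrier M" "d \<in> carrier M" for a b d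
      using that left_cancel by blast
    show "a = b" if "a \<otimes> d = b \<otimes> d" "a \<in> carrier M" "b \<in> carrier M" "d \<in> carrier M" for a b d
      using op.left_cancel[of d a b] that by (simp only: O)
  qed
  then have gauss: "gaussian_monoid M"
    using atomic has_gcds_lcms op.has_gcds_lcms by (simp add: gaussian_monoid_def)
  let ?one = "\<lambda>y. of_bool (y \<in> Y) :: nat"
  obtain \<Delta> where \<Delta>: "\<Delta> \<in> carrier M" "c \<Delta> = ?one"
    using ex_element[of ?one] by auto
  have rev_\<Delta>: "reverse_coordinates \<Delta> = ?one"
    by (simp add: reverse_coordinates_def \<Delta> permutes_in_image[OF p_inv_power_permutes])
  have "reverse_coordinates a \<le> ?one \<longleftrightarrow> c a \<le> ?one" for a
  proof -
    have q: "(p_inv ^^ degree a) permutes Y"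
      by (rule p_inv_power_permutes)
    have "reverse_coordinates a \<le> ?one \<longleftrightarrow>
        (\<forall>y. c a ((p_inv ^^ degree a) y) \<le> ?one ((p_inv ^^ degree a) y))"
      by (simp add: reverse_coordinates_def le_fun_def permutes_in_image[OF q])
    also have "\<dots> \<longleftrightarrow> c a \<le> ?one"
      using permutes_surj[OF q] unfolding le_fun_def by (metis surjD)
    finally show ?thesis .
  qed
  then have divs: "left_divisors M \<Delta> = right_divisors M \<Delta>"
    using \<Delta> by (auto simp: left_divisors_def right_divisors_def divides_iff op.divides_iff O rev_\<Delta>)
  have left: "left_divisors M \<Delta> = {a \<in> carrier M. c a \<le> ?one}"
    using \<Delta> by (auto simp: left_divisors_def divides_iff)
  have "c ` left_divisors M \<Delta> \<subseteq> (\<lambda>A y. of_bool (y \<in> A)) ` Pow Y"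
  proof
    fix v assume "v \<in> c ` left_divisors M \<Delta>"
    then have "v \<le> ?one"
      unfolding left by blast
    then have v: "v y \<le> ?one y" for y
      by (rule le_funD)
    have "v = (\<lambda>y. of_bool (y \<in> {y \<in> Y. v y = 1}))"
    proof
      fix y show "v y = of_bool (y \<in> {y \<in> Y. v y = 1})"
        using v[of y] by (cases "y \<in> Y") auto
    qed
    then show "v \<in> (\<lambda>A y. of_bool (y \<in> A)) ` Pow Y"
      by blast
  qed
  then have "finite (c ` left_divisors M \<Delta>)"
    by (rule finite_subset) (simp add: finite_Y)
  moreover have "inj_on c (left_divisors M \<Delta>)"
    using c_inject by (auto simp: inj_on_def left)
  ultimately have fin: "finite (left_divisors M \<Delta>)"
    by (rule finite_imageD)
  have "monoid_generated_by M (left_divisors M \<Delta>)"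
  proof (rule monoid_generated_by_if_degree_one)
    fix a assume a: "a \<in> carrier M" "degree a = 1"
    have "c a y \<le> ?one y" for y
    proof (cases "y \<in> Y")
      case True
      then show ?thesis
        using member_le_sum[of y Y "c a"] finite_Y a by (simp add: degree_def)
    qed (simp add: c_outside a)
    then show "a \<in> left_divisors M \<Delta>"
      using a by (simp add: left le_fun_def)
  qed (auto simp: left)
  then have "garside_element M \<Delta>"
    using \<Delta> divs fin by (simp add: garside_element_def)
  then show ?thesis
    using gauss by (auto simp: garside_monoid_def)
qed

end

section \<open>Commutation of the generators up to a twist\<close>

locale permutation_solution_presentation =
  fixes X :: "'a set" and f g :: "'a \<Rightarrow> 'a"
  assumes finite_X: "finite X"
    and f: "bij_betw f X X"
    and g: "bij_betw g X X"
    and fg: "\<And>x. x \<in> X \<Longrightarrow> f (g x) = g (f x)"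
begin

definition relators :: "('a word \<times> 'a word) set" where
  "relators = {([(x, True), (y, True)], [(g y, True), (f x, True)]) | x y. x \<in> X \<and> y \<in> X}"

abbreviation G :: "'a word set monoid" where
  "G \<equiv> presented_group X relators"

sublocale group G
  by (rule group_presented_group)

definition gen :: "'a \<Rightarrow> 'a word set" where
  "gen x = word_class X relators [(x, True)]"

lemma f_in [simp]: "x \<in> X \<Longrightarrow> f x \<in> X" and g_in [simp]: "x \<in> X \<Longrightarrow> g x \<in> X"
  using f g by (auto simp: bij_betw_def)

lemma gen_closed [simp]: "x \<in> X \<Longrightarrow> gen x \<in> carrier G"
  by (simp add: gen_def presented_group_def words_def)

lemma word_class_Cons:
  assumes "x \<in> X" "u \<in> words X"
  shows "word_class X relators ((x, b) # u) = word_class X relators [(x, b)] \<otimes>\<^bsub>G\<^esub> word_class X relators u"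
  using assms by (subst presented_group_mult) (auto simp: words_def)

lemma gen_mult:
  assumes "x \<in> X" "y \<in> X"
  shows "gen x \<otimes>\<^bsub>G\<^esub> gen y = gen (g y) \<otimes>\<^bsub>G\<^esub> gen (f x)"
proof -
  have w: "[(x, True), (y, True)] \<in> words X" "[(g y, True), (f x, True)] \<in> words X"
    using assms by (simp_all add: words_def)
  have "word_cong X relators [(x, True), (y, True)] [(g y, True), (f x, True)]"
    using assms w by (intro word_cong.relation) (auto simp: relators_def)
  then show ?thesis
    using assms w by (simp add: gen_def presented_group_mult words_def word_class_eq_iff)
qed

text \<open>In the group the solution becomes involutive: the second factor cancels in
  \<open>x \<cdot> f x = g (f x) \<cdot> f x\<close>.\<close>

lemma gen_g_f: "x \<in> X \<Longrightarrow> gen (g (f x)) = gen x"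
  using gen_mult[of x "f x"] by simp

lemma gen_exchange:
  assumes "x \<in> X" "z \<in> X"
  shows "gen x \<otimes>\<^bsub>G\<^esub> gen (f z) = gen z \<otimes>\<^bsub>G\<^esub> gen (f x)"
  using gen_mult[of x "f z"] gen_g_f assms by simp

text \<open>The exchange relation determines \<open>f x\<close> from \<open>x\<close> inside the group, so \<open>f\<close> induces a map on the set
  of generators of the group even where distinct letters of \<open>X\<close> become equal there.\<close>

lemma gen_f_cong:
  assumes "x \<in> X" "y \<in> X" "gen x = gen y"
  shows "gen (f x) = gen (f y)"
  using gen_exchange[of x y] assms by simp

text \<open>The map induced by \<open>f\<close> on the generators of the group, extended by the identity so that it is a
  permutation in the sense of \<open>permutes\<close>.\<close>

definition p :: "'a word set \<Rightarrow> 'a word set" where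
  "p c = (if c \<in> gen ` X then gen (f (inv_into X gen c)) else c)"

abbreviation p_inv :: "'a word set \<Rightarrow> 'a word set" where
  "p_inv \<equiv> inv_into UNIV p"

lemma p_gen:
  assumes "x \<in> X"
  shows "p (gen x) = gen (f x)"
proof -
  have "gen (inv_into X gen (gen x)) = gen x" "inv_into X gen (gen x) \<in> X"
    using assms by (simp_all add: f_inv_into_f inv_into_into)
  from gen_f_cong[OF this(2) assms this(1)] show ?thesis
    using assms by (simp add: p_def)
qed

lemma p_permutes: "p permutes gen ` X"
proof (rule bij_imp_permutes)
  have "p ` gen ` X = gen ` f ` X"
    by (auto simp: p_gen image_iff)
  also have "f ` X = X"
    using f by (simp add: bij_betw_def)
  finally have "p ` gen ` X = gen ` X" .
  then show "bij_betw p (gen ` X) (gen ` X)"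
    using finite_X by (simp add: bij_betw_def eq_card_imp_inj_on)
qed (simp add: p_def)

section \<open>Coordinates of positive words\<close>

text \<open>A positive letter acts by translation by a basis vector composed with the shift by \<open>p\<close>, that is, as the
  generator acts in the semidirect product; a negative letter acts by the inverse map. Integer values
  are needed so that this inverse exists.\<close>

fun letter_action :: "'a \<times> bool \<Rightarrow> ('a word set \<Rightarrow> int) \<Rightarrow> 'a word set \<Rightarrow> int" where
  "letter_action (x, True) w = (\<lambda>y. of_bool (y = gen x) + w (p y))"
| "letter_action (x, False) w = (\<lambda>y. w (p_inv y) - of_bool (p_inv y = gen x))"

definition action :: "'a word \<Rightarrow> ('a word set \<Rightarrow> int) \<Rightarrow> 'a word set \<Rightarrow> int" where
  "action u = foldr letter_action u"

text \<open>The action factors through the group. For the defining relation, both sides translate by the basis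
  vectors at \<open>x\<close> and at \<open>g y\<close>, because, in the group, \<open>p\<close> sends \<open>x\<close> to \<open>f x\<close> and \<open>g y\<close> to \<open>f (g y) = g (f y) = y\<close>.\<close>

lemma action_cong:
  assumes "word_cong X relators u v"
  shows "action u = action v"
  using assms
proof induction
  case (cancel x b)
  then show ?case
    by (cases b) (auto simp: action_def fun_eq_iff permutes_inverses[OF p_permutes])
next
  case (relation u v)
  then obtain x y where xy: "x \<in> X" "y \<in> X"
    and uv: "u = [(x, True), (y, True)]" "v = [(g y, True), (f x, True)]"
    by (auto simp: relators_def)
  have "p z = gen (f x) \<longleftrightarrow> z = gen x" for z
    using permutes_inj[OF p_permutes] p_gen[OF xy(1)] by (metis injD)
  moreover have "gen y = p (gen (g y))"
    using xy gen_g_f fg by (simp add: p_gen)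
  then have "p z = gen y \<longleftrightarrow> z = gen (g y)" for z
    using permutes_inj[OF p_permutes] by (metis injD)
  ultimately show ?case
    by (auto simp: action_def uv fun_eq_iff)
qed (auto simp: action_def)

primrec weight :: "'a list \<Rightarrow> 'a word set \<Rightarrow> nat" where
  "weight [] = (\<lambda>_. 0)"
| "weight (x # xs) = (\<lambda>y. of_bool (y = gen x) + weight xs (p y))"

primrec positive :: "'a list \<Rightarrow> 'a word set" where
  "positive [] = \<one>\<^bsub>G\<^esub>"
| "positive (x # xs) = gen x \<otimes>\<^bsub>G\<^esub> positive xs"

lemma positive_closed [simp]: "xs \<in> lists X \<Longrightarrow> positive xs \<in> carrier G"
  by (induction xs) auto

lemma positive_append:
  "xs \<in> lists X \<Longrightarrow> ys \<in> lists X \<Longrightarrow> positive (xs @ ys) = positive xs \<otimes>\<^bsub>G\<^esub> positive ys"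
  by (induction xs) (auto simp: m_assoc)

lemma positive_eq_word_class:
  assumes "xs \<in> lists X"
  shows "positive xs = word_class X relators (map (\<lambda>x. (x, True)) xs)"
  using assms
proof (induction xs)
  case (Cons x xs)
  then have "x \<in> X" "map (\<lambda>x. (x, True)) xs \<in> words X"
    by (auto simp: words_def)
  from word_class_Cons[OF this] Cons show ?case
    by (simp add: gen_def)
qed (simp add: presented_group_def)

lemma action_positive: "action (map (\<lambda>x. (x, True)) xs) (\<lambda>_. 0) = (\<lambda>y. int (weight xs y))"
  by (induction xs) (auto simp: action_def)

text \<open>The weight of a positive word is the image of the zero function under its action, so it depends only
  on the group element.\<close>

lemma weight_eq_if_positive_eq:
  assumes xs: "xs \<in> lists X" and ys: "ys \<in> lists X" and eq: "positive xs = positive ys"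
  shows "weight xs = weight ys"
proof -
  have "map (\<lambda>x. (x, True)) xs \<in> words X"
    using xs by (auto simp: words_def)
  then have "word_cong X relators (map (\<lambda>x. (x, True)) xs) (map (\<lambda>x. (x, True)) ys)"
    using eq by (simp add: positive_eq_word_class xs ys word_class_eq_iff)
  from action_cong[OF this] show ?thesis
    using action_positive[of xs] action_positive[of ys] by (simp add: fun_eq_iff)
qed

lemma weight_outside:
  "xs \<in> lists X \<Longrightarrow> y \<notin> gen ` X \<Longrightarrow> weight xs y = 0"
  by (induction xs arbitrary: y) (auto simp: p_def)

lemma sum_weight: "xs \<in> lists X \<Longrightarrow> (\<Sum>y\<in>gen ` X. weight xs y) = length xs"
proof (induction xs)
  case (Cons x xs)
  have "(\<Sum>y\<in>gen ` X. weight xs (p y)) = length xs"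
    using sum.permute[OF p_permutes, of "weight xs"] Cons by (simp add: comp_def)
  moreover have "(\<Sum>y\<in>gen ` X. of_bool (y = gen x)) = (1::nat)"
    using Cons.prems finite_X by (subst sum.mono_neutral_right[of _ "{gen x}"]) auto
  ultimately show ?case
    by (simp add: sum.distrib)
qed simp

lemma weight_append:
  "weight (xs @ ys) = (\<lambda>y. weight xs y + weight ys ((p ^^ length xs) y))"
  by (induction xs) (auto simp: funpow_swap1)

text \<open>If \<open>x\<close> is not the first letter \<open>y\<close>, then \<open>f x\<close> occurs in the weight of the remaining word, so by
  induction it can be brought to the second place, and \<open>y \<cdot> f x = x \<cdot> f y\<close>.\<close>

lemma positive_front:
  assumes "xs \<in> lists X" "x \<in> X" "weight xs (gen x) \<noteq> 0"
  shows "\<exists>ys\<in>lists X. positive xs = positive (x # ys)"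
  using assms
proof (induction xs arbitrary: x)
  case (Cons y xs)
  show ?case
  proof (cases "gen x = gen y")
    case True
    then show ?thesis
      using Cons.hyps by (intro bexI[of _ xs]) simp_all
  next
    case False
    then have "weight xs (gen (f x)) \<noteq> 0"
      using Cons.prems by (simp add: p_gen)
    then obtain zs where zs: "zs \<in> lists X" "positive xs = positive (f x # zs)"
      using Cons.IH[of "f x"] Cons.prems by auto
    have "positive (y # xs) = (gen y \<otimes>\<^bsub>G\<^esub> gen (f x)) \<otimes>\<^bsub>G\<^esub> positive zs"
      using Cons.hyps Cons.prems(1) zs by (simp add: m_assoc)
    also have "\<dots> = positive (x # f y # zs)"
      using Cons.hyps Cons.prems(1) zs gen_exchange[of y x] by (simp add: m_assoc)
    finally show ?thesis
      using Cons.hyps zs(1) by (intro bexI[of _ "f y # zs"]) simp_all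
  qed
qed simp

text \<open>Both words can be made to start with the same letter; what remains has equal weights again.\<close>

lemma positive_eq_if_weight_eq:
  assumes "xs \<in> lists X" "ys \<in> lists X" "weight xs = weight ys"
  shows "positive xs = positive ys"
  using assms
proof (induction xs arbitrary: ys)
  case Nil
  then have "length ys = 0"
    using sum_weight[of ys] by (simp flip: Nil.prems(2))
  then show ?case
    by simp
next
  case (Cons x xs)
  have "weight ys (gen x) \<noteq> 0"
    by (simp flip: Cons.prems(2))
  then obtain zs where zs: "zs \<in> lists X" "positive ys = positive (x # zs)"
    using positive_front[of ys x] Cons.prems(1) Cons.hyps(1) by blast
  have "weight ys = weight (x # zs)"
    using weight_eq_if_positive_eq[OF Cons.prems(1) _ zs(2)] zs(1) Cons.hyps(1) by auto
  then have eq: "weight xs (p y) = weight zs (p y)" for y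
    by (simp flip: Cons.prems(2) add: fun_eq_iff)
  have "weight xs = weight zs"
  proof
    fix y show "weight xs y = weight zs y"
      using eq[of "p_inv y"] by (simp add: permutes_inverses[OF p_permutes])
  qed
  then have "positive xs = positive zs"
    using Cons.IH[of zs] zs(1) by simp
  then show ?case
    by (simp add: zs(2))
qed

lemma weight_surj:
  assumes "\<And>y. y \<notin> gen ` X \<Longrightarrow> v y = 0"
  shows "\<exists>xs\<in>lists X. weight xs = v"
  using assms
proof (induction "\<Sum>y\<in>gen ` X. v y" arbitrary: v)
  case 0
  then have "v y = 0" for y
    using finite_X by (cases "y \<in> gen ` X") (auto simp: sum_eq_0_iff)
  then show ?case
    by (intro bexI[of _ "[]"]) auto
next
  case (Suc n)
  then obtain x where x: "x \<in> X" "v (gen x) \<noteq> 0"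
    by (metis (no_types, lifting) image_iff sum.neutral nat.distinct(1))
  \<comment> \<open>the unique vector with \<open>v = e + v' \<circ> p\<close>, where \<open>e\<close> is the basis vector at \<open>x\<close>\<close>
  define v' where "v' y = v (p_inv y) - of_bool (p_inv y = gen x)" for y
  have v': "v y = of_bool (y = gen x) + v' (p y)" for y
    using x(2) by (auto simp: v'_def permutes_inverses[OF p_permutes])
  have "v' y = 0" if "y \<notin> gen ` X" for y
    using Suc.prems that by (simp add: v'_def permutes_not_in[OF permutes_inv[OF p_permutes]])
  moreover have "n = (\<Sum>y\<in>gen ` X. v' y)"
  proof -
    have "Suc n = (\<Sum>y\<in>gen ` X. of_bool (y = gen x)) + (\<Sum>y\<in>gen ` X. v' (p y))"
      unfolding Suc.hyps(2) sum.distrib[symmetric] by (rule sum.cong[OF HOL.refl v'])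
    also have "(\<Sum>y\<in>gen ` X. of_bool (y = gen x)) = (1::nat)"
      using x(1) finite_X by (subst sum.mono_neutral_right[of _ "{gen x}"]) auto
    also have "(\<Sum>y\<in>gen ` X. v' (p y)) = (\<Sum>y\<in>gen ` X. v' y)"
      using sum.permute[OF p_permutes, of v'] by (simp add: comp_def)
    finally show ?thesis
      by simp
  qed
  ultimately obtain xs where "xs \<in> lists X" "weight xs = v'"
    using Suc.hyps(1)[of v'] by blast
  then show ?case
    using x(1) v' by (intro bexI[of _ "x # xs"]) auto
qed

section \<open>The monoid of positive elements\<close>

definition M :: "'a word set monoid" where
  "M = G\<lparr>carrier := positive ` lists X\<rparr>"

lemma carrier_M: "carrier M = positive ` lists X"
  and mult_M [simp]: "a \<otimes>\<^bsub>M\<^esub> b = a \<otimes>\<^bsub>G\<^esub> b"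
  and one_M: "\<one>\<^bsub>M\<^esub> = \<one>\<^bsub>G\<^esub>"
  by (simp_all add: M_def)

lemma M_subset: "a \<in> carrier M \<Longrightarrow> a \<in> carrier G"
  unfolding carrier_M using positive_closed by blast

lemma gen_in_M: "x \<in> X \<Longrightarrow> gen x \<in> carrier M"
  using imageI[of "[x]" "lists X" positive] by (simp add: carrier_M)

lemma monoid_M: "monoid M"
proof (rule monoidI)
  show "a \<otimes>\<^bsub>M\<^esub> b \<in> carrier M" if ab: "a \<in> carrier M" "b \<in> carrier M" for a b
  proof -
    obtain xs ys where "xs \<in> lists X" "a = positive xs" "ys \<in> lists X" "b = positive ys"
      using ab unfolding carrier_M by blast
    then have "a \<otimes>\<^bsub>M\<^esub> b = positive (xs @ ys)" "xs @ ys \<in> lists X"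
      by (simp_all add: positive_append)
    then show ?thesis
      unfolding carrier_M by blast
  qed
  show "\<one>\<^bsub>M\<^esub> \<in> carrier M"
    using imageI[of "[]" "lists X" positive] by (simp add: carrier_M one_M)
qed (simp_all add: one_M m_assoc M_subset)

text \<open>Any positive word for \<open>a\<close> may be chosen, since they all have the same weight.\<close>

definition coordinates :: "'a word set \<Rightarrow> 'a word set \<Rightarrow> nat" where
  "coordinates a = weight (SOME xs. xs \<in> lists X \<and> positive xs = a)"

lemma coordinates_positive:
  assumes "xs \<in> lists X"
  shows "coordinates (positive xs) = weight xs"
proof -
  let ?ys = "SOME ys. ys \<in> lists X \<and> positive ys = positive xs"
  have "?ys \<in> lists X \<and> positive ?ys = positive xs"
    by (rule someI[of _ xs]) (simp add: assms)
  then show ?thesis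
    using weight_eq_if_positive_eq[of ?ys xs] assms by (simp add: coordinates_def)
qed

lemma M_is_twisted: "twisted_free_commutative_monoid M (gen ` X) p coordinates"
proof (intro twisted_free_commutative_monoid.intro twisted_free_commutative_monoid_axioms.intro)
  show "monoid M" "finite (gen ` X)" "p permutes gen ` X"
    using monoid_M finite_X p_permutes by auto
  show "bij_betw coordinates (carrier M) {v. \<forall>y. y \<notin> gen ` X \<longrightarrow> v y = 0}"
  proof (rule bij_betw_imageI)
    show "inj_on coordinates (carrier M)"
    proof (rule inj_onI)
      fix a b assume *: "a \<in> carrier M" "b \<in> carrier M" "coordinates a = coordinates b"
      then obtain xs ys where "xs \<in> lists X" "a = positive xs" "ys \<in> lists X" "b = positive ys"
        unfolding carrier_M by blast
      then show "a = b"
        using positive_eq_if_weight_eq[of xs ys] *(3) by (simp add: coordinates_positive)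
    qed
    have "coordinates ` carrier M = weight ` lists X"
      unfolding carrier_M image_image by (rule image_cong[OF HOL.refl coordinates_positive])
    also have "\<dots> = {v. \<forall>y. y \<notin> gen ` X \<longrightarrow> v y = 0}"
    proof (intro equalityI subsetI)
      fix v assume "v \<in> {v. \<forall>y. y \<notin> gen ` X \<longrightarrow> (v y :: nat) = 0}"
      then show "v \<in> weight ` lists X"
        using weight_surj[of v] by blast
    qed (use weight_outside in auto)
    finally show "coordinates ` carrier M = {v. \<forall>y. y \<notin> gen ` X \<longrightarrow> v y = 0}" .
  qed
  show "coordinates (a \<otimes>\<^bsub>M\<^esub> b) =
      (\<lambda>y. coordinates a y + coordinates b ((p ^^ (\<Sum>z\<in>gen ` X. coordinates a z)) y))"
    if a: "a \<in> carrier M" and b: "b \<in> carrier M" for a b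
  proof -
    obtain xs ys where "xs \<in> lists X" "a = positive xs" "ys \<in> lists X" "b = positive ys"
      using a b unfolding carrier_M by blast
    then show ?thesis
      using coordinates_positive[of "xs @ ys"]
      by (simp add: coordinates_positive positive_append weight_append sum_weight)
  qed
qed

lemma garside_M: "garside_monoid M"
  using M_is_twisted by (rule twisted_free_commutative_monoid.garside)

section \<open>The group as a group of fractions\<close>

lemma common_right_multiple:
  assumes "a \<in> carrier M" "b \<in> carrier M"
  obtains c d where "c \<in> carrier M" "d \<in> carrier M" "a \<otimes>\<^bsub>G\<^esub> c = b \<otimes>\<^bsub>G\<^esub> d"
proof -
  have "has_gcds_lcms M"
    using garside_M by (simp add: garside_monoid_def gaussian_monoid_def)
  then obtain m where "m lcmof\<^bsub>M\<^esub> a b"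
    using assms by (auto simp: has_gcds_lcms_def)
  then show ?thesis
    using that unfolding islcm_def factor_def mult_M by metis
qed

lemma common_left_multiple:
  assumes "a \<in> carrier M" "b \<in> carrier M"
  obtains c d where "c \<in> carrier M" "d \<in> carrier M" "c \<otimes>\<^bsub>G\<^esub> a = d \<otimes>\<^bsub>G\<^esub> b"
proof -
  have "has_gcds_lcms (opposite_monoid M)"
    using garside_M by (simp add: garside_monoid_def gaussian_monoid_def)
  then obtain m where "m lcmof\<^bsub>opposite_monoid M\<^esub> a b"
    using assms by (auto simp: has_gcds_lcms_def opposite_monoid_def)
  then show ?thesis
    using that by (auto simp: islcm_def factor_def opposite_monoid_def)
qed

lemma word_class_inverse_letter:
  assumes "x \<in> X"
  shows "word_class X relators [(x, False)] = inv\<^bsub>G\<^esub> gen x"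
proof -
  have "[(x, False)] \<in> words X" "[(x, True)] \<in> words X"
    using assms by (simp_all add: words_def)
  moreover from this have "word_class X relators [(x, False), (x, True)] = word_class X relators []"
    using assms word_cong.cancel[of x X relators False] by (simp add: word_class_eq_iff words_def)
  ultimately have "word_class X relators [(x, False)] \<otimes>\<^bsub>G\<^esub> gen x = \<one>\<^bsub>G\<^esub>"
    by (simp add: gen_def presented_group_mult) (simp add: presented_group_def)
  moreover have "word_class X relators [(x, False)] \<in> carrier G"
    using assms by (simp add: presented_group_def words_def)
  ultimately show ?thesis
    using assms inv_equality gen_closed by blast
qed

lemma carrier_induct [consumes 1, case_names one gen inv_gen]:
  assumes "a \<in> carrier G" "P \<one>\<^bsub>G\<^esub>"
    and "\<And>x a. x \<in> X \<Longrightarrow> a \<in> carrier G \<Longrightarrow> P a \<Longrightarrow> P (gen x \<otimes>\<^bsub>G\<^esub> a)"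
    and "\<And>x a. x \<in> X \<Longrightarrow> a \<in> carrier G \<Longrightarrow> P a \<Longrightarrow> P (inv\<^bsub>G\<^esub> gen x \<otimes>\<^bsub>G\<^esub> a)"
  shows "P a"
proof -
  have "P (word_class X relators u)" if "u \<in> words X" for u
    using that
  proof (induction u)
    case Nil
    then show ?case
      using assms(2) by (simp add: presented_group_def)
  next
    case (Cons l u)
    obtain x b where l: "l = (x, b)"
      by (cases l)
    have xu: "x \<in> X" "u \<in> words X"
      using Cons.prems by (auto simp: l words_def)
    moreover from this have "word_class X relators u \<in> carrier G"
      by (simp add: presented_group_def)
    ultimately show ?case
      using Cons.IH assms(3,4) word_class_Cons[of x u b]
      by (cases b) (auto simp: l word_class_inverse_letter simp flip: gen_def)
  qed
  then show ?thesis
    using assms(1) by (auto simp: presented_group_def)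
qed

text \<open>A generator is absorbed into the numerator. An inverse generator passes through the numerator by a
  common right multiple: if \<open>x \<cdot> c = a \<cdot> d\<close>, then the inverse of \<open>x\<close> times \<open>a\<close> is \<open>c\<close> times the
  inverse of \<open>d\<close>.\<close>

lemma right_fraction:
  assumes "x \<in> carrier G"
  shows "\<exists>a\<in>carrier M. \<exists>b\<in>carrier M. x = a \<otimes>\<^bsub>G\<^esub> inv\<^bsub>G\<^esub> b"
  using assms
proof (induction rule: carrier_induct)
  case one
  then show ?case
    using monoid.one_closed[OF monoid_M] by (intro bexI[of _ "\<one>\<^bsub>G\<^esub>"]) (simp_all add: one_M)
next
  case (gen x y)
  then obtain a b where "a \<in> carrier M" "b \<in> carrier M" "y = a \<otimes>\<^bsub>G\<^esub> inv\<^bsub>G\<^esub> b"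
    by blast
  then show ?case
    using gen.hyps monoid.m_closed[OF monoid_M, of "gen x" a] gen_in_M
    by (intro bexI[of _ "gen x \<otimes>\<^bsub>G\<^esub> a"] bexI[of _ b]) (simp_all add: m_assoc M_subset)
next
  case (inv_gen x y)
  then obtain a b where ab: "a \<in> carrier M" "b \<in> carrier M" "y = a \<otimes>\<^bsub>G\<^esub> inv\<^bsub>G\<^esub> b"
    by blast
  obtain c d where cd: "c \<in> carrier M" "d \<in> carrier M" "gen x \<otimes>\<^bsub>G\<^esub> c = a \<otimes>\<^bsub>G\<^esub> d"
    using common_right_multiple[OF gen_in_M[OF inv_gen.hyps(1)] ab(1)] by blast
  note car = gen_closed[OF inv_gen.hyps(1)] M_subset[OF ab(1)] M_subset[OF ab(2)]
    M_subset[OF cd(1)] M_subset[OF cd(2)]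
  have a: "a = gen x \<otimes>\<^bsub>G\<^esub> (c \<otimes>\<^bsub>G\<^esub> inv\<^bsub>G\<^esub> d)"
    using car cd(3) by (metis inv_closed inv_solve_right m_assoc m_closed)
  have "inv\<^bsub>G\<^esub> gen x \<otimes>\<^bsub>G\<^esub> y = c \<otimes>\<^bsub>G\<^esub> inv\<^bsub>G\<^esub> (b \<otimes>\<^bsub>G\<^esub> d)"
    using car unfolding ab(3) by (subst a) (simp add: m_assoc inv_mult_group flip: m_assoc[of "inv\<^bsub>G\<^esub> gen x"])
  moreover have "b \<otimes>\<^bsub>G\<^esub> d \<in> carrier M"
    using monoid.m_closed[OF monoid_M, of b d] ab cd by simp
  ultimately show ?case
    using cd(1) by blast
qed

lemma left_fraction:
  assumes "x \<in> carrier G"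
  shows "\<exists>a\<in>carrier M. \<exists>b\<in>carrier M. x = inv\<^bsub>G\<^esub> a \<otimes>\<^bsub>G\<^esub> b"
proof -
  obtain a b where ab: "a \<in> carrier M" "b \<in> carrier M" "x = a \<otimes>\<^bsub>G\<^esub> inv\<^bsub>G\<^esub> b"
    using right_fraction[OF assms] by blast
  obtain c d where cd: "c \<in> carrier M" "d \<in> carrier M" "c \<otimes>\<^bsub>G\<^esub> a = d \<otimes>\<^bsub>G\<^esub> b"
    using common_left_multiple[OF ab(1,2)] by blast
  note car = M_subset[OF ab(1)] M_subset[OF ab(2)] M_subset[OF cd(1)] M_subset[OF cd(2)]
  have "c \<otimes>\<^bsub>G\<^esub> x = d"
    using car cd(3) ab(3) by (metis inv_closed inv_solve_right m_assoc m_closed)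
  then have "x = inv\<^bsub>G\<^esub> c \<otimes>\<^bsub>G\<^esub> d"
    using car assms by (metis inv_solve_left)
  then show ?thesis
    using cd(1,2) by blast
qed

lemma garside_group: "garside_group G"
proof -
  have "id \<in> hom M G"
    using M_subset by (auto simp: hom_def)
  then have "group_of_fractions M G"
    using left_fraction right_fraction is_group
    unfolding group_of_fractions_def by (intro conjI bexI[of _ id]) auto
  then show ?thesis
    using garside_M by (auto simp: garside_group_def)
qed

end

theorem theorem7p6:
  fixes X :: "'a set" and S :: "'a \<times> 'a \<Rightarrow> 'a \<times> 'a"
  assumes "finite X"
    and "permutation_solution X S"
    and "non_degenerate X S"
    and "braided X S"
  shows "garside_group (structure_group X S)"
proof -
  obtain f g where X: "X \<noteq> {}" "f \<in> X \<rightarrow> X" "g \<in> X \<rightarrow> X"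
    and S: "\<And>x y. x \<in> X \<Longrightarrow> y \<in> X \<Longrightarrow> S (x, y) = (g y, f x)"
    using assms(2) unfolding permutation_solution_def by blast
  interpret permutation_solution_presentation X f g
    using assms non_degenerate_iff[of X S g f] braided_iff[of X f g S] X S
    by unfold_locales blast+
  have "structure_group X S = G"
    unfolding structure_group_def relators_def
    by (rule arg_cong[of _ _ "presented_group X"]) (auto simp: S)
  then show ?thesis
    using garside_group by simp
qed

end
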